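(* Let $q$ be a prime power, let $1\le k<n$ be integers with $k\le n/2$, write $n=hk+r$ with $0\le r\le k-1$, and let $p,p'\in\mathbb{F}_q[x]$ be irreducible monic polynomials of degree $k$ and $k+r$ respectively. Let $\mathcal{N}_q(k,n,2k)$ be the set of all network codes $\mathcal{D}\subseteq\mathcal{G}_q(k,n)$ of minimum distance $2k$. Then the partial spread code $\mathcal{C}_q(k,n;p,p')$ is a maximal element of $\mathcal{N}_q(k,n,2k)$ with respect to inclusion.
   Context: $\mathcal{G}_q(k,n)$ denotes the set of $k$-dimensional subspaces of $\mathbb{F}_q^n$. A network code in $\mathcal{G}_q(k,n)$ is a subset with at least two elements. The subspace distance is $d(U,V):=\dim U+\dim V-2\dim(U\cap V)$, and the minimum distance of a network code is the minimum of $d(U,V)$ over distinct codewords $U,V$. For a monic polynomial $f=\sum_{i=0}^m f_i x^i$ of degree $m\ge 1$, the companion matrix $\mathbf{M}(f)$ is the $m\times m$ matrix with entries $1$ on the superdiagonal, last row $(-f_0,\dots,-f_{m-1})$, and all other entries $0$. For a square matrix $Q$, $\mathbb{F}_q[Q]$ is the $\mathbb{F}_q$-algebra of matrices generated by $Q$ (and the identity). Definition of $\mathcal{C}_q(k,n;p,p')$: let $P:=\mathbf{M}(p)$ and $P':=\mathbf{M}(p')$. For a $(k+r)\times(k+r)$ matrix $A$ let $A_{(k)}$ be the $k\times(k+r)$ matrix formed by its last $k$ rows. For $1\le i\le h-1$ let $\mathcal{M}_i(p,p')$ be the set of all $k\times n$ block matrices $\begin{bmatrix} 0_k & \cdots &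 0_k & I_k & A_{i+1} & \cdots & A_{h-1} & A_{(k)}\end{bmatrix}$ with $A_{i+1},\dots,A_{h-1}\in\mathbb{F}_q[P]$, $A\in\mathbb{F}_q[P']$, where $I_k$ is the $i$-th $k\times k$ block. Then $$\mathcal{C}_q(k,n;p,p'):=\bigcup_{i=1}^{h-1}\{\mathrm{rowsp}(M): M\in\mathcal{M}_i(p,p')\}\cup\{\mathrm{rowsp}\begin{bmatrix}0_k&\cdots&0_k&0_{k\times r}&I_k\end{bmatrix}\}.$$ This is a set of $k$-dimensional subspaces of $\mathbb{F}_q^n$ with pairwise trivial intersection, i.e. a network code of minimum distance $2k$. *)

theory Defs
  imports
    "Jordan_Normal_Form.VS_Connect"
    "HOL-Computational_Algebra.Polynomial_Factorial"
begin

text \<open>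
  The field with \<open>q\<close> elements is a type \<open>'a :: {field, finite}\<close> with \<open>q = CARD('a)\<close>, and the
  space of row vectors of length \<open>n\<close> over it is \<open>module_vec TYPE('a) n\<close>.
\<close>

definition subspace_dim :: "nat \<Rightarrow> 'a::field vec set \<Rightarrow> nat" where
  "subspace_dim n U = vectorspace.dim class_ring ((module_vec TYPE('a) n)\<lparr>carrier := U\<rparr>)"

definition grassmannian :: "nat \<Rightarrow> nat \<Rightarrow> 'a::field vec set set" where
  "grassmannian k n =
     {U. VectorSpace.subspace class_ring U (module_vec TYPE('a) n) \<and> subspace_dim n U = k}"

definition subspace_dist :: "nat \<Rightarrow> 'a::field vec set \<Rightarrow> 'a vec set \<Rightarrow> int" where
  "subspace_dist n U V =
     int (subspace_dim n U) + int (subspace_dim n V) - 2 * int (subspace_dim n (U \<inter> V))"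

text \<open>Over a finite field the Grassmannian is finite, so \<open>card\<close> and \<open>Min\<close> below are only used
  on finite sets.\<close>

definition network_code :: "nat \<Rightarrow> nat \<Rightarrow> 'a::{field,finite} vec set set \<Rightarrow> bool" where
  "network_code k n D \<longleftrightarrow> D \<subseteq> grassmannian k n \<and> 2 \<le> card D"

definition min_dist :: "nat \<Rightarrow> 'a::{field,finite} vec set set \<Rightarrow> int" where
  "min_dist n D = Min {subspace_dist n U V | U V. U \<in> D \<and> V \<in> D \<and> U \<noteq> V}"

definition network_codes :: "nat \<Rightarrow> nat \<Rightarrow> nat \<Rightarrow> 'a::{field,finite} vec set set set" where
  "network_codes k n d = {D. network_code k n D \<and> min_dist n D = int d}"

definition companion_matrix :: "'a::field poly \<Rightarrow> 'a mat" where
  "companion_matrix f =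
     (let m = degree f in
      mat m m (\<lambda>(i, j). if i = m - 1 then - coeff f j else if j = i + 1 then 1 else 0))"

inductive_set generated_algebra :: "'a::field mat \<Rightarrow> 'a mat set" for Q :: "'a mat" where
  one: "1\<^sub>m (dim_row Q) \<in> generated_algebra Q"
| gen: "Q \<in> generated_algebra Q"
| add: "A \<in> generated_algebra Q \<Longrightarrow> B \<in> generated_algebra Q \<Longrightarrow> A + B \<in> generated_algebra Q"
| smult: "A \<in> generated_algebra Q \<Longrightarrow> c \<cdot>\<^sub>m A \<in> generated_algebra Q"
| mult: "A \<in> generated_algebra Q \<Longrightarrow> B \<in> generated_algebra Q \<Longrightarrow> A * B \<in> generated_algebra Q"

definition last_rows :: "nat \<Rightarrow> 'a mat \<Rightarrow> 'a mat" where
  "last_rows k A = mat k (dim_col A) (\<lambda>(i, j). A $$ (dim_row A - k + i, j))"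

text \<open>
  With \<open>n = h * k + r\<close> and \<open>r < k\<close>, this is the \<open>k \<times> n\<close> block matrix \<open>[B 1, \<dots>, B h]\<close>,
  numbered from 1, in which \<open>B 1, \<dots>, B (h - 1)\<close> are \<open>k \<times> k\<close> and \<open>B h\<close> is \<open>k \<times> (k + r)\<close>:
  block \<open>j\<close> starts at column \<open>(j - 1) * k\<close>, and \<open>B h\<close> fills all remaining columns.
\<close>
definition block_row :: "nat \<Rightarrow> nat \<Rightarrow> (nat \<Rightarrow> 'a mat) \<Rightarrow> 'a mat" where
  "block_row k n B =
     mat k n (\<lambda>(a, c). let j = min (c div k + 1) (n div k) in B j $$ (a, c - (j - 1) * k))"

definition code_matrices ::
    "nat \<Rightarrow> nat \<Rightarrow> 'a::field poly \<Rightarrow> 'a poly \<Rightarrow> nat \<Rightarrow> 'a mat set" where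
  "code_matrices k n p p' i =
     (let h = n div k in
      {block_row k n B | B.
         (\<forall>j. 1 \<le> j \<and> j < i \<longrightarrow> B j = 0\<^sub>m k k) \<and>
         B i = 1\<^sub>m k \<and>
         (\<forall>j. i < j \<and> j \<le> h - 1 \<longrightarrow> B j \<in> generated_algebra (companion_matrix p)) \<and>
         (\<exists>A \<in> generated_algebra (companion_matrix p'). B h = last_rows k A)})"

definition partial_spread_code ::
    "nat \<Rightarrow> nat \<Rightarrow> 'a::field poly \<Rightarrow> 'a poly \<Rightarrow> 'a vec set set" where
  "partial_spread_code k n p p' =
     (let h = n div k in
      (\<Union>i \<in> {1..h - 1}. vec_space.row_space n ` code_matrices k n p p' i) \<union>
      {vec_space.row_space n (mat k n (\<lambda>(a, c). if c = n - k + a then 1 else 0))})"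

end

theory Submission
  imports Defs "HOL-Library.Cardinality"
begin

text \<open>Right multiplication by the companion matrix of \<open>p\<close> is multiplication by \<open>X\<close> on
  \<open>F[X]/(p)\<close>, so for irreducible \<open>p\<close> the algebra it generates acts simply transitively on the
  nonzero row vectors. Hence each vector with a nonzero entry among its first \<open>(h - 1) k\<close>
  coordinates lies in exactly one codeword: its first nonzero block is the coefficient vector,
  which together with the later blocks determines the matrices. A further \<open>k\<close>-dimensional
  subspace that meets every codeword trivially would consist of vectors supported on the last
  \<open>k + r\<close> coordinates; since it also meets the last codeword trivially, it would embed into the
  space of dimension \<open>r < k\<close> of the first \<open>r\<close> of these. Counting elements excludes this.\<close>

section \<open>Subspaces over a finite field\<close>

text \<open>Vectors are counted as extensional functions on the index set; \<open>restrict\<close>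
  discards the values beyond the length, and \<open>vec n\<close> is the inverse.\<close>

lemma bij_betw_restrict_carrier_vec:
  "bij_betw (\<lambda>v. restrict (($) v) {..<n}) (carrier_vec n) ({..<n} \<rightarrow>\<^sub>E (UNIV :: 'a set))"
proof (rule bij_betw_byWitness[where f' = "vec n"])
  show "\<forall>v\<in>carrier_vec n. vec n (restrict (($) v) {..<n}) = v" by auto
  show "\<forall>f\<in>{..<n} \<rightarrow>\<^sub>E UNIV. restrict (($) (vec n f)) {..<n} = (f :: nat \<Rightarrow> 'a)"
  proof (intro ballI extensionalityI)
    fix f :: "nat \<Rightarrow> 'a" assume "f \<in> {..<n} \<rightarrow>\<^sub>E UNIV"
    then show "f \<in> extensional {..<n}" by (simp add: PiE_iff)
  qed auto
  show "vec n ` ({..<n} \<rightarrow>\<^sub>E UNIV) \<subseteq> (carrier_vec n :: 'a vec set)"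
    by (intro image_subsetI vec_carrier)
qed (rule image_subsetI, simp)

lemma finite_carrier_vec: "finite (carrier_vec n :: 'a::finite vec set)"
  using bij_betw_finite[OF bij_betw_restrict_carrier_vec[where 'a='a, of n]]
  by (simp add: finite_PiE)

lemma card_carrier_vec: "card (carrier_vec n :: 'a::finite vec set) = CARD('a) ^ n"
  using bij_betw_same_card[OF bij_betw_restrict_carrier_vec[where 'a='a, of n]]
  by (simp add: card_funcsetE)

text \<open>Coordinates with respect to a basis identify \<open>U\<close> with the functions from
  that basis into the field. From here on dimensions are found by counting elements.\<close>

lemma card_subspace:
  fixes U :: "'a::{field,finite} vec set"
  assumes "VectorSpace.subspace class_ring U (module_vec TYPE('a) n)"
  shows "card U = CARD('a) ^ subspace_dim n U"
proof -
  interpret V: vec_space "TYPE('a)" n .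
  interpret U: vectorspace class_ring "V.vs U"
    using assms V.subspace_is_vs by blast
  have "U \<subseteq> carrier_vec n"
    using assms by (auto simp: VectorSpace.subspace_def submodule_def module_vec_simps)
  then have fin: "finite U" using finite_carrier_vec finite_subset by blast
  \<comment> \<open>The finite set \<open>U\<close> generates itself, which yields a finite
    basis.\<close>
  have "U.gen_set U"
    using U.in_own_span[of U] U.span_is_subset2[of U] by auto
  then have "U.fin_dim" unfolding U.fin_dim_def using fin by auto
  then obtain \<beta> where \<beta>: "finite \<beta>" "U.basis \<beta>" using U.finite_basis_exists by blast
  then have "\<beta> \<subseteq> U" by (auto simp: U.basis_def)
  then have crit: "\<exists>!a. a \<in> \<beta> \<rightarrow>\<^sub>E (UNIV :: 'a set) \<and> U.lincomb a \<beta> = v" if "v \<in> U" for v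
    using U.basis_criterion[of \<beta>] \<beta> that by simp
  have closed: "U.lincomb a \<beta> \<in> U" for a
    using U.lincomb_closed[of \<beta> a] \<open>\<beta> \<subseteq> U\<close> by auto
  have "bij_betw (\<lambda>a. U.lincomb a \<beta>) (\<beta> \<rightarrow>\<^sub>E (UNIV :: 'a set)) U"
    unfolding bij_betw_def
  proof
    show "inj_on (\<lambda>a. U.lincomb a \<beta>) (\<beta> \<rightarrow>\<^sub>E (UNIV :: 'a set))"
      using crit closed by (intro inj_onI) blast
    show "(\<lambda>a. U.lincomb a \<beta>) ` (\<beta> \<rightarrow>\<^sub>E UNIV) = U"
      using crit closed by blast
  qed
  then have "card U = CARD('a) ^ card \<beta>"
    using card_funcsetE[OF \<open>finite \<beta>\<close>, of "UNIV :: 'a set"] bij_betw_same_card by metis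
  then show ?thesis using U.dim_basis \<beta> by (simp add: subspace_dim_def)
qed

lemma card_field_gt_1: "1 < CARD('a::{field,finite})"
proof -
  have "card {0, 1 :: 'a} \<le> CARD('a)" by (rule card_mono) auto
  then show ?thesis by simp
qed

section \<open>Row spaces, with the row vector \<open>y M\<close> written as
  \<open>M\<^sup>T *\<^sub>v y\<close>\<close>

lemma index_transpose_mult_vec:
  fixes M :: "'a::comm_semiring_0 mat"
  assumes "j < dim_col M" "dim_vec y = dim_row M"
  shows "(M\<^sup>T *\<^sub>v y) $ j = (\<Sum>i<dim_row M. M $$ (i, j) * y $ i)"
  using assms by (auto simp: scalar_prod_def atLeast0LessThan)

text \<open>The transpose of a matrix sends \<open>unit_vec k i\<close> to row \<open>i\<close> of
  that matrix, so unit vectors already recover every entry.\<close>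

lemma eq_mat_if_transpose_mult_eq:
  fixes A B :: "'a::comm_semiring_1 mat"
  assumes A: "A \<in> carrier_mat k m" and B: "B \<in> carrier_mat k m"
    and eq: "\<And>y. y \<in> carrier_vec k \<Longrightarrow> A\<^sup>T *\<^sub>v y = B\<^sup>T *\<^sub>v y"
  shows "A = B"
proof (rule eq_matI)
  fix i j assume "i < dim_row B" "j < dim_col B"
  then have ij: "i < k" "j < m" using B by auto
  have "(C\<^sup>T *\<^sub>v unit_vec k i) $ j = C $$ (i, j)" if "C \<in> carrier_mat k m" for C :: "'a mat"
    using that ij by (subst index_transpose_mult_vec) (auto simp: unit_vec_def if_distrib if_distribR cong: if_cong)
  then show "A $$ (i, j) = B $$ (i, j)" using eq[of "unit_vec k i"] A B by (metis unit_vec_carrier)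
qed (use A B in auto)

lemma row_space_image:
  fixes M :: "'a::field mat"
  assumes "M \<in> carrier_mat k n"
  shows "vec_space.row_space n M = (\<lambda>y. M\<^sup>T *\<^sub>v y) ` carrier_vec k"
  using assms by (auto simp: vec_space.row_space_eq)

text \<open>An injective image of \<open>carrier_vec k\<close> has \<open>CARD('a) ^ k\<close>
  elements, and as \<open>CARD('a) > 1\<close> this number determines the dimension.\<close>

lemma row_space_in_grassmannian:
  fixes M :: "'a::{field,finite} mat"
  assumes M: "M \<in> carrier_mat k n" and inj: "inj_on (\<lambda>y. M\<^sup>T *\<^sub>v y) (carrier_vec k)"
  shows "vec_space.row_space n M \<in> grassmannian k n"
proof -
  interpret V: vec_space "TYPE('a)" n .
  have sub: "VectorSpace.subspace class_ring (V.row_space M) V.V"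
    unfolding V.row_space_def using M by (intro V.span_is_subspace) (auto simp: rows_def)
  have "card (V.row_space M) = CARD('a) ^ k"
    using card_image[OF inj] by (simp add: row_space_image[OF M] card_carrier_vec)
  then show ?thesis using sub card_subspace[OF sub] card_field_gt_1[where 'a='a]
    by (simp add: grassmannian_def)
qed

lemma subspace_facts:
  fixes U :: "'a::field vec set"
  assumes "VectorSpace.subspace class_ring U (module_vec TYPE('a) n)"
  shows "U \<subseteq> carrier_vec n" "0\<^sub>v n \<in> U"
    and "u \<in> U \<Longrightarrow> v \<in> U \<Longrightarrow> u + v \<in> U" and "u \<in> U \<Longrightarrow> c \<cdot>\<^sub>v u \<in> U"
  using assms by (auto simp: VectorSpace.subspace_def submodule_def module_vec_simps)

lemma subspace_diff:
  fixes U :: "'a::field vec set"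
  assumes U: "VectorSpace.subspace class_ring U (module_vec TYPE('a) n)" and "u \<in> U" "v \<in> U"
  shows "u - v \<in> U"
proof -
  have "u \<in> carrier_vec n" "v \<in> carrier_vec n" using subspace_facts(1)[OF U] assms by auto
  then have "u - v = u + (- 1) \<cdot>\<^sub>v v" by (intro eq_vecI) auto
  then show ?thesis using subspace_facts(3,4)[OF U] assms by simp
qed

lemma subspace_Int:
  fixes U V :: "'a::field vec set"
  assumes "VectorSpace.subspace class_ring U (module_vec TYPE('a) n)"
    and "VectorSpace.subspace class_ring V (module_vec TYPE('a) n)"
  shows "VectorSpace.subspace class_ring (U \<inter> V) (module_vec TYPE('a) n)"
  using assms by (auto simp: VectorSpace.subspace_def submodule_def)

lemma subspace_dim_eq_0_iff:
  fixes U :: "'a::{field,finite} vec set"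
  assumes U: "VectorSpace.subspace class_ring U (module_vec TYPE('a) n)"
  shows "subspace_dim n U = 0 \<longleftrightarrow> U = {0\<^sub>v n}"
proof -
  have "subspace_dim n U = 0 \<longleftrightarrow> card U = 1"
    using card_subspace[OF U] card_field_gt_1[where 'a='a] by simp
  also have "\<dots> \<longleftrightarrow> U = {0\<^sub>v n}"
    using subspace_facts(2)[OF U] by (auto simp: card_1_singleton_iff)
  finally show ?thesis .
qed

section \<open>Minimum distance and trivial intersection\<close>

lemma zero_in_grassmannian: "U \<in> grassmannian k n \<Longrightarrow> 0\<^sub>v n \<in> (U :: 'a::field vec set)"
  by (simp add: grassmannian_def subspace_facts(2))

lemma subspace_dist_grassmannian:
  assumes "U \<in> grassmannian k n" "V \<in> grassmannian k n"
  shows "subspace_dist n U V = int (2 * k) - 2 * int (subspace_dim n (U \<inter> V))"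
  using assms by (simp add: subspace_dist_def grassmannian_def)

lemma subspace_dist_ge_iff:
  fixes U V :: "'a::{field,finite} vec set"
  assumes U: "U \<in> grassmannian k n" and V: "V \<in> grassmannian k n"
  shows "int (2 * k) \<le> subspace_dist n U V \<longleftrightarrow> U \<inter> V = {0\<^sub>v n}"
proof -
  have "VectorSpace.subspace class_ring (U \<inter> V) (module_vec TYPE('a) n)"
    using U V by (intro subspace_Int) (simp_all add: grassmannian_def)
  then show ?thesis using subspace_dist_grassmannian[OF U V] subspace_dim_eq_0_iff by auto
qed

lemma finite_grassmannian: "finite (grassmannian k n :: 'a::{field,finite} vec set set)"
proof (rule finite_subset)
  show "grassmannian k n \<subseteq> Pow (carrier_vec n :: 'a vec set)"
    using subspace_facts(1) by (auto simp: grassmannian_def)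
qed (simp add: finite_carrier_vec)

lemma finite_subspace_dists:
  fixes D :: "'a::{field,finite} vec set set"
  assumes "D \<subseteq> grassmannian k n"
  shows "finite {subspace_dist n U V | U V. U \<in> D \<and> V \<in> D \<and> U \<noteq> V}"
proof (rule finite_subset)
  have "finite D" using assms finite_grassmannian finite_subset by blast
  then show "finite ((\<lambda>(U, V). subspace_dist n U V) ` (D \<times> D))" by blast
qed auto

text \<open>No two members of the Grassmannian are further apart than \<open>2 * k\<close>, so a
  minimum equal to \<open>2 * k\<close> means that every distance reaches this bound, that is, every
  intersection has dimension 0.\<close>

lemma network_codes_2k_iff:
  fixes D :: "'a::{field,finite} vec set set"
  shows "D \<in> network_codes k n (2 * k) \<longleftrightarrow> D \<subseteq> grassmannian k n \<and> 2 \<le> card D \<and>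
    (\<forall>U\<in>D. \<forall>V\<in>D. U \<noteq> V \<longrightarrow> U \<inter> V = {0\<^sub>v n})"
proof (cases "D \<subseteq> grassmannian k n \<and> 2 \<le> card D")
  case True
  then have D: "D \<subseteq> grassmannian k n" "2 \<le> card D" by auto
  let ?S = "{subspace_dist n U V | U V. U \<in> D \<and> V \<in> D \<and> U \<noteq> V}"
  \<comment> \<open>Two distinct codewords exist, so \<open>Min\<close> is taken over a nonempty
    set.\<close>
  have "\<not> (\<exists>U. D \<subseteq> {U})"
    using D(2) card_mono[of "{U}" D for U] by (metis card.empty card_insert_if finite.intros empty_iff
      not_less_eq_eq numeral_2_eq_2 One_nat_def)
  then have ne: "?S \<noteq> {}" by blast
  have fin: "finite ?S" using finite_subspace_dists D by blast
  have le: "subspace_dist n U V \<le> int (2 * k)" if "U \<in> D" "V \<in> D" for U V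
    using subspace_dist_grassmannian[of U k n V] that subsetD[OF D(1)] by simp
  have "min_dist n D = int (2 * k) \<longleftrightarrow> int (2 * k) \<le> min_dist n D"
  proof -
    obtain U V where "U \<in> D" "V \<in> D" "Min ?S = subspace_dist n U V"
      using Min_in[OF fin ne] by blast
    then have "min_dist n D \<le> int (2 * k)" using le by (simp add: min_dist_def)
    then show ?thesis by linarith
  qed
  also have "\<dots> \<longleftrightarrow> (\<forall>U\<in>D. \<forall>V\<in>D. U \<noteq> V \<longrightarrow> int (2 * k) \<le> subspace_dist n U V)"
    unfolding min_dist_def Min_ge_iff[OF fin ne] by auto
  also have "\<dots> \<longleftrightarrow> (\<forall>U\<in>D. \<forall>V\<in>D. U \<noteq> V \<longrightarrow> U \<inter> V = {0\<^sub>v n})"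
    using subspace_dist_ge_iff D(1) by (metis subsetD)
  finally show ?thesis using D by (simp add: network_codes_def network_code_def)
qed (auto simp: network_codes_def network_code_def)

section \<open>The algebra generated by a companion matrix\<close>

text \<open>A row vector is identified with the residue modulo \<open>p\<close> whose coefficients are its entries.
  The last row of the companion matrix of \<open>p\<close> is then reduction modulo \<open>p\<close>, so every element
  of the generated algebra acts as multiplication by a polynomial.\<close>

definition vec_poly :: "'a::zero vec \<Rightarrow> 'a poly" where
  "vec_poly v = Poly (list_of_vec v)"

lemma coeff_vec_poly: "coeff (vec_poly v) i = (if i < dim_vec v then v $ i else 0)"
  by (simp add: vec_poly_def nth_default_def list_of_vec_index)

lemma vec_poly_inject: "vec_poly v = vec_poly w \<longleftrightarrow> v = w" if "dim_vec v = dim_vec w"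
  using that by (auto simp: poly_eq_iff coeff_vec_poly intro!: eq_vecI split: if_splits)

lemma vec_poly_add:
  "dim_vec v = dim_vec w \<Longrightarrow> vec_poly (v + w) = vec_poly v + (vec_poly w :: 'a::comm_monoid_add poly)"
  by (simp add: poly_eq_iff coeff_vec_poly)

lemma vec_poly_smult: "vec_poly (c \<cdot>\<^sub>v v) = Polynomial.smult c (vec_poly v :: 'a::comm_semiring_0 poly)"
  by (simp add: poly_eq_iff coeff_vec_poly)

text \<open>The vectors are exactly the reduced residues. Positive degree is used for the zero
  vector, whose polynomial has degree 0.\<close>

lemma vec_poly_mod:
  fixes p :: "'a::field poly"
  assumes "dim_vec v = degree p" "0 < degree p"
  shows "vec_poly v mod p = vec_poly v"
proof (rule mod_poly_less)
  show "degree (vec_poly v) < degree p"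
    using assms le_degree leading_coeff_0_iff by (metis coeff_vec_poly leI degree_0)
qed

lemma companion_matrix_carrier: "companion_matrix p \<in> carrier_mat (degree p) (degree p)"
  by (simp add: companion_matrix_def Let_def)

text \<open>Multiplying by \<open>X\<close>, here \<open>monom 1 1\<close>, shifts the coefficients
  and creates a term \<open>x $ (m - 1)\<close> times \<open>X ^ m\<close>; subtracting that
  multiple of the monic \<open>p\<close> removes it.\<close>

lemma companion_mult:
  fixes p :: "'a::field poly"
  assumes "lead_coeff p = 1" "0 < degree p" "x \<in> carrier_vec (degree p)"
  shows "vec_poly ((companion_matrix p)\<^sup>T *\<^sub>v x) = (monom 1 1 * vec_poly x) mod p"
proof -
  define m where "m = degree p"
  define P where "P = companion_matrix p"
  have P: "P \<in> carrier_mat m m" by (simp add: P_def m_def companion_matrix_carrier)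
  have x: "dim_vec x = m" using assms by (simp add: m_def)
  \<comment> \<open>The superdiagonal produces the shift, the last row the subtracted multiple of
    \<open>p\<close>.\<close>
  have "(P\<^sup>T *\<^sub>v x) $ j = (if j = 0 then 0 else x $ (j - 1)) - x $ (m - 1) * coeff p j" if "j < m" for j
  proof -
    obtain l where l: "m = Suc l" using \<open>j < m\<close> by (cases m) auto
    have "(P\<^sup>T *\<^sub>v x) $ j = (\<Sum>i<m. P $$ (i, j) * x $ i)"
      using P x \<open>j < m\<close> by (subst index_transpose_mult_vec) auto
    also have "\<dots> = (\<Sum>i<l. (if j = i + 1 then x $ i else 0)) - coeff p j * x $ l"
      using \<open>j < m\<close> l by (auto simp: P_def companion_matrix_def Let_def m_def[symmetric] intro!: sum.cong)
    also have "(\<Sum>i<l. (if j = i + 1 then x $ i else 0)) = (if j = 0 then 0 else x $ (j - 1))"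
      using \<open>j < m\<close> l by (cases j) (auto simp: sum.delta)
    finally show ?thesis using l by simp
  qed
  \<comment> \<open>At \<open>i = m\<close> both sides vanish because \<open>p\<close> is monic;
    beyond \<open>m\<close> there are no coefficients.\<close>
  then have "coeff (vec_poly (P\<^sup>T *\<^sub>v x)) i =
      coeff (pCons 0 (vec_poly x) - Polynomial.smult (x $ (m - 1)) p) i" for i
    using assms P x coeff_eq_0[of p i]
    by (cases "i < m"; cases "i = m"; cases i)
      (auto simp: coeff_vec_poly coeff_pCons m_def split: nat.splits)
  then have "vec_poly (P\<^sup>T *\<^sub>v x) = monom 1 1 * vec_poly x - Polynomial.smult (x $ (m - 1)) p"
    by (simp add: poly_eq_iff monom_Suc)
  moreover have "Polynomial.smult (x $ (m - 1)) p mod p = 0"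
    by (simp add: mod_smult_left)
  ultimately have "vec_poly (P\<^sup>T *\<^sub>v x) mod p = (monom 1 1 * vec_poly x) mod p"
    using mod_diff_right_eq[of "monom 1 1 * vec_poly x" "Polynomial.smult (x $ (m - 1)) p" p] by simp
  then show ?thesis using vec_poly_mod[of "P\<^sup>T *\<^sub>v x" p] P assms by (simp add: m_def P_def)
qed

lemma smult_transpose_mult_vec:
  fixes M :: "'a::comm_semiring_0 mat"
  assumes "M \<in> carrier_mat k m" "y \<in> carrier_vec k"
  shows "(c \<cdot>\<^sub>m M)\<^sup>T *\<^sub>v y = c \<cdot>\<^sub>v (M\<^sup>T *\<^sub>v y)"
  using assms by (intro eq_vecI) (auto simp: index_transpose_mult_vec sum_distrib_left mult.assoc simp del: index_mult_mat_vec)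

lemma generated_algebra_carrier:
  "A \<in> generated_algebra Q \<Longrightarrow> Q \<in> carrier_mat m m \<Longrightarrow> A \<in> carrier_mat m m"
  by (induction rule: generated_algebra.induct) auto

text \<open>Multiplications by polynomials modulo \<open>p\<close> are closed under sums, scalar
  multiples and composition. The multiplier \<open>f\<close> depends on \<open>A\<close> alone, not
  on \<open>x\<close>.\<close>

lemma generated_algebra_acts:
  fixes p :: "'a::field poly"
  assumes A: "A \<in> generated_algebra (companion_matrix p)" and p: "lead_coeff p = 1" "0 < degree p"
  shows "\<exists>f. \<forall>x\<in>carrier_vec (degree p). vec_poly (A\<^sup>T *\<^sub>v x) = (f * vec_poly x) mod p"
  using A
proof induction
  case one
  have "vec_poly x = (1 * vec_poly x) mod p" if "x \<in> carrier_vec (degree p)" for x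
    using that p by (simp add: vec_poly_mod)
  then show ?case using companion_matrix_carrier[of p]
    by (metis carrier_matD(1) one_mult_mat_vec transpose_one)
next
  case gen
  then show ?case using companion_mult p by blast
next
  case (add A B)
  then obtain f g where fg:
    "\<And>x. x \<in> carrier_vec (degree p) \<Longrightarrow> vec_poly (A\<^sup>T *\<^sub>v x) = (f * vec_poly x) mod p"
    "\<And>x. x \<in> carrier_vec (degree p) \<Longrightarrow> vec_poly (B\<^sup>T *\<^sub>v x) = (g * vec_poly x) mod p"
    by blast
  have carr: "A \<in> carrier_mat (degree p) (degree p)" "B \<in> carrier_mat (degree p) (degree p)"
    using add companion_matrix_carrier generated_algebra_carrier by blast+
  have "vec_poly ((A + B)\<^sup>T *\<^sub>v x) = ((f + g) * vec_poly x) mod p" if "x \<in> carrier_vec (degree p)" for x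
    using that carr fg[OF that]
    by (simp add: transpose_add[of _ "degree p" "degree p"] add_mult_distrib_mat_vec[of _ "degree p" "degree p"]
        vec_poly_add distrib_right poly_mod_add_left)
  then show ?case by blast
next
  case (smult A c)
  then obtain f where f:
    "\<And>x. x \<in> carrier_vec (degree p) \<Longrightarrow> vec_poly (A\<^sup>T *\<^sub>v x) = (f * vec_poly x) mod p"
    by blast
  have carr: "A \<in> carrier_mat (degree p) (degree p)"
    using smult companion_matrix_carrier generated_algebra_carrier by blast
  have "vec_poly ((c \<cdot>\<^sub>m A)\<^sup>T *\<^sub>v x) = (Polynomial.smult c f * vec_poly x) mod p" if "x \<in> carrier_vec (degree p)" for x
    using f[OF that] by (simp add: smult_transpose_mult_vec[OF carr that] vec_poly_smult mod_smult_left)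
  then show ?case by blast
next
  case (mult A B)
  then obtain f g where fg:
    "\<And>x. x \<in> carrier_vec (degree p) \<Longrightarrow> vec_poly (A\<^sup>T *\<^sub>v x) = (f * vec_poly x) mod p"
    "\<And>x. x \<in> carrier_vec (degree p) \<Longrightarrow> vec_poly (B\<^sup>T *\<^sub>v x) = (g * vec_poly x) mod p"
    by blast
  have carr: "A \<in> carrier_mat (degree p) (degree p)" "B \<in> carrier_mat (degree p) (degree p)"
    using mult companion_matrix_carrier generated_algebra_carrier by blast+
  have "vec_poly ((A * B)\<^sup>T *\<^sub>v x) = ((g * f) * vec_poly x) mod p" if x: "x \<in> carrier_vec (degree p)" for x
  proof -
    have Ax: "A\<^sup>T *\<^sub>v x \<in> carrier_vec (degree p)" using carr x by simp
    \<comment> \<open>Matrices act on row vectors from the right, so \<open>A\<close> acts before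
      \<open>B\<close>.\<close>
    have "(A * B)\<^sup>T *\<^sub>v x = B\<^sup>T *\<^sub>v (A\<^sup>T *\<^sub>v x)"
      using carr x by (simp add: transpose_mult[of _ "degree p" "degree p"] 
         assoc_mult_mat_vec[of _ "degree p" "degree p" _ "degree p"])
    then show ?thesis using fg(1)[OF x] fg(2)[OF Ax] by (simp add: mod_mult_right_eq mult.assoc)
  qed
  then show ?case by blast
qed

text \<open>Horner's scheme: \<open>pCons a f\<close> is \<open>a + X * f\<close>, hence it is
  realised by \<open>a\<close> times the identity plus \<open>A * P\<close>, where \<open>A\<close>
  realises \<open>f\<close> and \<open>P\<close> is the companion matrix.\<close>

lemma ex_generated_algebra_acts:
  fixes p f :: "'a::field poly"
  assumes p: "lead_coeff p = 1" "0 < degree p"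
  shows "\<exists>A\<in>generated_algebra (companion_matrix p).
    \<forall>x\<in>carrier_vec (degree p). vec_poly (A\<^sup>T *\<^sub>v x) = (f * vec_poly x) mod p"
proof (induction f)
  case 0
  let ?m = "degree p" and ?I = "1\<^sub>m (degree p) :: 'a mat"
  \<comment> \<open>The zero matrix enters the algebra as the zero multiple of the identity.\<close>
  have "vec_poly ((0 \<cdot>\<^sub>m ?I)\<^sup>T *\<^sub>v x) = 0" if x: "x \<in> carrier_vec ?m" for x
    by (simp add: smult_transpose_mult_vec[OF one_carrier_mat x] vec_poly_smult)
  moreover have "0 \<cdot>\<^sub>m ?I \<in> generated_algebra (companion_matrix p)"
    using generated_algebra.smult generated_algebra.one companion_matrix_carrier[of p] by (metis carrier_matD(1))
  ultimately show ?case by (metis mod_0 mult_zero_left)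
next
  case (pCons a f)
  let ?m = "degree p" and ?I = "1\<^sub>m (degree p) :: 'a mat" and ?P = "companion_matrix p"
  from pCons obtain A where A: "A \<in> generated_algebra ?P"
    "\<And>x. x \<in> carrier_vec ?m \<Longrightarrow> vec_poly (A\<^sup>T *\<^sub>v x) = (f * vec_poly x) mod p" by blast
  have I: "?I \<in> generated_algebra ?P"
    using generated_algebra.one companion_matrix_carrier[of p] by (metis carrier_matD(1))
  let ?B = "a \<cdot>\<^sub>m ?I + A * ?P"
  have carr: "A \<in> carrier_mat ?m ?m" "?P \<in> carrier_mat ?m ?m"
    using A companion_matrix_carrier generated_algebra_carrier by blast+
  have "vec_poly (?B\<^sup>T *\<^sub>v x) = (pCons a f * vec_poly x) mod p" if x: "x \<in> carrier_vec ?m" for x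
  proof -
    have Ax: "A\<^sup>T *\<^sub>v x \<in> carrier_vec ?m" using carr x by simp
    have "?B\<^sup>T *\<^sub>v x = (a \<cdot>\<^sub>m ?I)\<^sup>T *\<^sub>v x + (A * ?P)\<^sup>T *\<^sub>v x"
      using carr x by (simp add: transpose_add[of _ ?m ?m] add_mult_distrib_mat_vec[of _ ?m ?m])
    also have "(a \<cdot>\<^sub>m ?I)\<^sup>T *\<^sub>v x = a \<cdot>\<^sub>v x"
      using x by (simp add: smult_transpose_mult_vec[OF one_carrier_mat x])
    also have "(A * ?P)\<^sup>T *\<^sub>v x = ?P\<^sup>T *\<^sub>v (A\<^sup>T *\<^sub>v x)"
      using carr x by (simp add: transpose_mult[of _ ?m ?m] assoc_mult_mat_vec[of _ ?m ?m _ ?m])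
    finally have "vec_poly (?B\<^sup>T *\<^sub>v x) =
        Polynomial.smult a (vec_poly x) + (monom 1 1 * ((f * vec_poly x) mod p)) mod p"
      using carr x companion_mult[OF p Ax] A(2)[OF x] by (simp add: vec_poly_add vec_poly_smult)
    also have "Polynomial.smult a (vec_poly x) = Polynomial.smult a (vec_poly x) mod p"
      using x p by (simp add: mod_smult_left vec_poly_mod)
    also have "\<dots> + (monom 1 1 * ((f * vec_poly x) mod p)) mod p
        = (Polynomial.smult a (vec_poly x) + monom 1 1 * (f * vec_poly x)) mod p"
      by (simp add: mod_mult_right_eq poly_mod_add_left)
    also have "Polynomial.smult a (vec_poly x) + monom 1 1 * (f * vec_poly x) = pCons a f * vec_poly x"
      by (simp add: monom_Suc)
    finally show ?thesis .
  qed
  moreover have "?B \<in> generated_algebra ?P"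
    using A(1) I generated_algebra.intros by metis
  ultimately show ?case by blast
qed

text \<open>A nonzero vector is a nonzero reduced residue. For irreducible \<open>p\<close> it can
  therefore be cancelled.\<close>

lemma vec_poly_not_dvd:
  fixes p :: "'a::field poly"
  assumes "x \<in> carrier_vec (degree p)" "x \<noteq> 0\<^sub>v (degree p)" "0 < degree p"
  shows "\<not> p dvd vec_poly x"
proof
  assume "p dvd vec_poly x"
  then have "vec_poly x = 0" using vec_poly_mod[of x p] assms by (auto simp: mod_eq_0_iff_dvd)
  then have "vec_poly x = vec_poly (0\<^sub>v (degree p))"
    by (simp add: poly_eq_iff coeff_vec_poly)
  then show False using assms vec_poly_inject[of x "0\<^sub>v (degree p)"] by simp
qed

lemma dvd_diff_if_mult_mod_eq:
  fixes p :: "'a::field poly"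
  assumes "irreducible p" "\<not> p dvd h" "(f * h) mod p = (g * h) mod p"
  shows "p dvd f - g"
proof -
  have "p dvd (f - g) * h"
    using assms(3) by (simp add: mod_eq_dvd_iff left_diff_distrib)
  then show ?thesis
    using assms field_poly_irreducible_imp_prime prime_elem_dvd_multD by blast
qed

text \<open>If \<open>A\<close> and \<open>B\<close> multiply by \<open>f\<close> and
  \<open>g\<close>, cancelling the single nonzero residue \<open>x\<close> makes \<open>f\<close>
  and \<open>g\<close> congruent modulo \<open>p\<close>, so the matrices agree on all
  vectors.\<close>

lemma generated_algebra_act_inj:
  fixes p :: "'a::field poly"
  assumes p: "irreducible p" "lead_coeff p = 1" "0 < degree p"
    and AB: "A \<in> generated_algebra (companion_matrix p)" "B \<in> generated_algebra (companion_matrix p)"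
    and x: "x \<in> carrier_vec (degree p)" "x \<noteq> 0\<^sub>v (degree p)" and eq: "A\<^sup>T *\<^sub>v x = B\<^sup>T *\<^sub>v x"
  shows "A = B"
proof -
  let ?m = "degree p"
  have carr: "A \<in> carrier_mat ?m ?m" "B \<in> carrier_mat ?m ?m"
    using AB companion_matrix_carrier generated_algebra_carrier by blast+
  obtain f g where fg:
    "\<And>x. x \<in> carrier_vec ?m \<Longrightarrow> vec_poly (A\<^sup>T *\<^sub>v x) = (f * vec_poly x) mod p"
    "\<And>x. x \<in> carrier_vec ?m \<Longrightarrow> vec_poly (B\<^sup>T *\<^sub>v x) = (g * vec_poly x) mod p"
    using generated_algebra_acts AB p by metis
  have "p dvd f - g"
    using dvd_diff_if_mult_mod_eq[OF p(1) vec_poly_not_dvd[OF x p(3)]] fg x eq by metis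
  then have "(f * h) mod p = (g * h) mod p" for h
    by (metis mod_eq_dvd_iff mod_mult_left_eq)
  then have "vec_poly (A\<^sup>T *\<^sub>v y) = vec_poly (B\<^sup>T *\<^sub>v y)" if "y \<in> carrier_vec ?m" for y
    using fg[OF that] by simp
  then have "A\<^sup>T *\<^sub>v y = B\<^sup>T *\<^sub>v y" if "y \<in> carrier_vec ?m" for y
    using that carr by (subst (asm) vec_poly_inject) auto
  then show ?thesis using eq_mat_if_transpose_mult_eq carr by blast
qed

text \<open>By cancellation, multiplying residues \<open>y\<close> by the fixed nonzero
  \<open>x\<close> is injective; on a finite set it is then surjective, so no inverse of
  \<open>x\<close> has to be constructed.\<close>

lemma generated_algebra_act_surj:
  fixes p :: "'a::{field,finite} poly"
  assumes p: "irreducible p" "lead_coeff p = 1" "0 < degree p"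
    and x: "x \<in> carrier_vec (degree p)" "x \<noteq> 0\<^sub>v (degree p)" and v: "v \<in> carrier_vec (degree p)"
  shows "\<exists>A\<in>generated_algebra (companion_matrix p). A\<^sup>T *\<^sub>v x = v"
proof -
  let ?m = "degree p" and ?K = "generated_algebra (companion_matrix p)"
  have "\<exists>A. A \<in> ?K \<and> (\<forall>x\<in>carrier_vec ?m. vec_poly (A\<^sup>T *\<^sub>v x) = (vec_poly y * vec_poly x) mod p)" for y
    using ex_generated_algebra_acts[OF p(2,3)] by blast
  then obtain A where A: "\<And>y. A y \<in> ?K"
    "\<And>y x. x \<in> carrier_vec ?m \<Longrightarrow> vec_poly ((A y)\<^sup>T *\<^sub>v x) = (vec_poly y * vec_poly x) mod p"
    by metis
  have carr: "A y \<in> carrier_mat ?m ?m" for y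
    using A companion_matrix_carrier generated_algebra_carrier by blast
  let ?F = "\<lambda>y. (A y)\<^sup>T *\<^sub>v x"
  have "inj_on ?F (carrier_vec ?m)"
  proof (rule inj_onI)
    fix y z :: "'a vec" assume yz: "y \<in> carrier_vec ?m" "z \<in> carrier_vec ?m" and "?F y = ?F z"
    then have "p dvd vec_poly y - vec_poly z"
      using dvd_diff_if_mult_mod_eq[OF p(1) vec_poly_not_dvd[OF x p(3)]] A(2)[OF x(1)] by metis
    then have "vec_poly y = vec_poly z"
      using vec_poly_mod[of y p] vec_poly_mod[of z p] yz p by (simp flip: mod_eq_dvd_iff)
    then show "y = z" using yz by (subst (asm) vec_poly_inject) auto
  qed
  moreover have "?F ` carrier_vec ?m \<subseteq> carrier_vec ?m"
    using mult_mat_vec_carrier[OF transpose_carrier_mat[THEN iffD2, OF carr] x(1)] by blast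
  ultimately have "?F ` carrier_vec ?m = carrier_vec ?m"
    using endo_inj_surj finite_carrier_vec by blast
  with v have "v \<in> ?F ` carrier_vec ?m" by (simp only:)
  then obtain y where "v = ?F y" by (rule imageE)
  then show ?thesis using A(1) by (intro bexI[of _ "A y"]) simp_all
qed

section \<open>Codewords\<close>

lemma last_rows_carrier:
  "A \<in> carrier_mat m w \<Longrightarrow> last_rows k A \<in> carrier_mat k w"
  by (simp add: last_rows_def)

text \<open>The \<open>r\<close> rows cut off meet only the zeros put in front of \<open>y\<close>.
  The wide last block can thus be studied through the full square matrix.\<close>

lemma last_rows_mult:
  fixes A :: "'a::comm_semiring_0 mat"
  assumes A: "A \<in> carrier_mat (r + k) w" and y: "y \<in> carrier_vec k"
  shows "(last_rows k A)\<^sup>T *\<^sub>v y = A\<^sup>T *\<^sub>v (0\<^sub>v r @\<^sub>v y)"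
proof (rule eq_vecI)
  fix j assume "j < dim_vec (A\<^sup>T *\<^sub>v (0\<^sub>v r @\<^sub>v y))"
  then have j: "j < w" using A by simp
  have "(A\<^sup>T *\<^sub>v (0\<^sub>v r @\<^sub>v y)) $ j = (\<Sum>i<r + k. A $$ (i, j) * (0\<^sub>v r @\<^sub>v y) $ i)"
    using A y j by (subst index_transpose_mult_vec) auto
  also have "\<dots> = (\<Sum>i\<in>{r..<r + k}. A $$ (i, j) * (0\<^sub>v r @\<^sub>v y) $ i)"
    using y by (intro sum.mono_neutral_right) auto
  also have "\<dots> = (\<Sum>i<k. A $$ (r + i, j) * y $ i)"
    using y by (intro sum.reindex_bij_witness[of _ "\<lambda>i. r + i" "\<lambda>i. i - r"]) auto
  also have "\<dots> = ((last_rows k A)\<^sup>T *\<^sub>v y) $ j"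
    using A y j by (subst index_transpose_mult_vec) (auto simp: last_rows_def)
  finally show "((last_rows k A)\<^sup>T *\<^sub>v y) $ j = (A\<^sup>T *\<^sub>v (0\<^sub>v r @\<^sub>v y)) $ j" by simp
qed (use A in \<open>simp add: last_rows_def\<close>)

text \<open>Given \<open>r < k\<close>, the bound \<open>2 \<le> h\<close> is equivalent to
  \<open>k \<le> n / 2\<close>. The degree \<open>r + k\<close> follows the order of the padded
  vectors \<open>0\<^sub>v r @\<^sub>v y\<close>.\<close>

locale partial_spread =
  fixes k n h r :: nat and p p' :: "'a::{field,finite} poly"
  assumes k: "0 < k" and h: "2 \<le> h" and n: "n = h * k + r" and r: "r < k"
    and p: "irreducible p" "lead_coeff p = 1" "degree p = k"
    and p': "irreducible p'" "lead_coeff p' = 1" "degree p' = r + k"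
begin

section \<open>Splitting the coordinates into blocks\<close>

lemma n_div_k: "n div k = h"
  using n r by simp

definition width :: "nat \<Rightarrow> nat" where
  "width j = (if j = h then r + k else k)"

definition block :: "nat \<Rightarrow> 'a vec \<Rightarrow> 'a vec" where
  "block j v = vec (width j) (\<lambda>b. v $ ((j - 1) * k + b))"

text \<open>The cap at \<open>h\<close> matters: for the last \<open>r\<close> columns of the wide
  block the quotient plus one would be \<open>h + 1\<close>.\<close>

lemma block_column:
  assumes "1 \<le> j" "j \<le> h" "b < width j"
  shows "(j - 1) * k + b < n" "min (((j - 1) * k + b) div k + 1) h = j"
proof -
  have "(j - 1) * k + b < n \<and> min (((j - 1) * k + b) div k + 1) h = j"
  proof (cases "j = h")
    case True
    then have "(j - 1) * k + k = h * k" using h by (simp add: mult_eq_if)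
    then show ?thesis using True assms n h k by (simp add: width_def)
  next
    case False
    have "(j - 1) * k + b < (j - 1) * k + k" using False assms by (simp add: width_def)
    also have "\<dots> = j * k" using assms by (simp add: mult_eq_if)
    also have "\<dots> \<le> n" unfolding n using assms by (intro trans_le_add1 mult_right_mono) auto
    finally show ?thesis using False assms k by (simp add: width_def)
  qed
  then show "(j - 1) * k + b < n" "min (((j - 1) * k + b) div k + 1) h = j" by auto
qed

lemma column_in_block:
  assumes "c < n"
  obtains j b where "1 \<le> j" "j \<le> h" "b < width j" "c = (j - 1) * k + b"
proof (cases "c < (h - 1) * k")
  case True
  then have "c div k < h - 1" using k by (simp add: less_mult_imp_div_less)
  then show ?thesis using that[of "c div k + 1" "c mod k"] k by (auto simp: width_def)
next
  case False
  have "(h - 1) * k + k = h * k" using h by (simp add: mult_eq_if)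
  then show ?thesis using that[of h "c - (h - 1) * k"] False assms n h by (auto simp: width_def)
qed

lemma eq_if_blocks_eq:
  assumes "v \<in> carrier_vec n" "w \<in> carrier_vec n"
    and eq: "\<And>j. 1 \<le> j \<Longrightarrow> j \<le> h \<Longrightarrow> block j v = block j w"
  shows "v = w"
proof (rule eq_vecI)
  fix c assume "c < dim_vec w"
  then have "c < n" using assms by simp
  then show "v $ c = w $ c"
  proof (rule column_in_block)
    fix j b assume jb: "1 \<le> j" "j \<le> h" "b < width j" "c = (j - 1) * k + b"
    then have "block j v $ b = block j w $ b" using eq by simp
    then show "v $ c = w $ c" using jb by (simp add: block_def)
  qed
qed (use assms in simp)

lemma block_row_carrier: "block_row k n B \<in> carrier_mat k n"
  by (simp add: block_row_def)

lemma block_mult: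
  assumes B: "B j \<in> carrier_mat k (width j)" and j: "1 \<le> j" "j \<le> h" and y: "y \<in> carrier_vec k"
  shows "block j ((block_row k n B)\<^sup>T *\<^sub>v y) = (B j)\<^sup>T *\<^sub>v y"
proof (rule eq_vecI)
  fix b assume "b < dim_vec ((B j)\<^sup>T *\<^sub>v y)"
  then have b: "b < width j" using B by simp
  define c where "c = (j - 1) * k + b"
  have c: "c < n" "min (c div k + 1) h = j" "c - (j - 1) * k = b"
    using block_column[OF j b] by (simp_all add: c_def)
  have "block_row k n B $$ (i, c) = B j $$ (i, b)" if "i < k" for i
    using that c by (simp add: block_row_def n_div_k Let_def)
  then have "((block_row k n B)\<^sup>T *\<^sub>v y) $ c = (\<Sum>i<k. B j $$ (i, b) * y $ i)"
    using y c(1) block_row_carrier[of B] by (subst index_transpose_mult_vec) auto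
  also have "\<dots> = ((B j)\<^sup>T *\<^sub>v y) $ b"
    using y B b by (subst index_transpose_mult_vec) auto
  finally show "block j ((block_row k n B)\<^sup>T *\<^sub>v y) $ b = ((B j)\<^sup>T *\<^sub>v y) $ b"
    using b by (simp add: block_def c_def)
qed (use B in \<open>simp add: block_def\<close>)

text \<open>The matrices allowed to the right of the identity block, with the narrow blocks and the
  wide last one under a single name.\<close>

definition blocks :: "nat \<Rightarrow> 'a mat set" where
  "blocks j = (if j = h then last_rows k ` generated_algebra (companion_matrix p')
     else generated_algebra (companion_matrix p))"

lemma generated_algebra_carriers:
  "A \<in> generated_algebra (companion_matrix p) \<Longrightarrow> A \<in> carrier_mat k k"
  "A \<in> generated_algebra (companion_matrix p') \<Longrightarrow> A \<in> carrier_mat (r + k) (r + k)"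
  using companion_matrix_carrier[of p] companion_matrix_carrier[of p'] p(3) p'(3)
    generated_algebra_carrier by metis+

lemma blocks_carrier: "B \<in> blocks j \<Longrightarrow> B \<in> carrier_mat k (width j)"
  by (auto simp: blocks_def width_def intro: generated_algebra_carriers last_rows_carrier split: if_splits)

lemma padded_nonzero:
  assumes "y \<in> carrier_vec k" "y \<noteq> 0\<^sub>v k"
  shows "0\<^sub>v r @\<^sub>v y \<in> carrier_vec (degree p')" "0\<^sub>v r @\<^sub>v y \<noteq> 0\<^sub>v (degree p' ) "
proof -
  show "0\<^sub>v r @\<^sub>v y \<in> carrier_vec (degree p')" using assms p' by simp
  obtain i where "i < k" "y $ i \<noteq> 0" using assms by (metis eq_vecI carrier_vecD index_zero_vec)
  then have "(0\<^sub>v r @\<^sub>v y) $ (r + i) \<noteq> 0\<^sub>v (degree p') $ (r + i)" using assms p' by simp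
  then show "0\<^sub>v r @\<^sub>v y \<noteq> 0\<^sub>v (degree p')" by metis
qed

text \<open>For the last block, \<open>y\<close> padded with \<open>r\<close> zeros is a nonzero
  residue modulo \<open>p'\<close>, so even the full square matrices coincide.\<close>

lemma blocks_act_inj:
  assumes y: "y \<in> carrier_vec k" "y \<noteq> 0\<^sub>v k" and BC: "B \<in> blocks j" "C \<in> blocks j"
    and eq: "B\<^sup>T *\<^sub>v y = C\<^sup>T *\<^sub>v y"
  shows "B = C"
proof (cases "j = h")
  case True
  then obtain A A' where A: "A \<in> generated_algebra (companion_matrix p')" "B = last_rows k A"
    "A' \<in> generated_algebra (companion_matrix p')" "C = last_rows k A'"
    using BC by (auto simp: blocks_def)
  then have "A\<^sup>T *\<^sub>v (0\<^sub>v r @\<^sub>v y) = A'\<^sup>T *\<^sub>v (0\<^sub>v r @\<^sub>v y)"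
    using eq last_rows_mult[OF generated_algebra_carriers(2)[OF A(1)] y(1)]
      last_rows_mult[OF generated_algebra_carriers(2)[OF A(3)] y(1)] by simp
  then have "A = A'"
    using generated_algebra_act_inj[OF p'(1,2) _ A(1,3) padded_nonzero[OF y]] p' k by simp
  then show ?thesis using A by simp
next
  case False
  then show ?thesis using generated_algebra_act_inj[OF p(1,2) _ _ _ _ _ eq] p(3) k y BC
    by (simp add: blocks_def)
qed

text \<open>The same padding carries transitivity modulo \<open>p'\<close> over to the last
  block.\<close>

lemma blocks_act_surj:
  assumes y: "y \<in> carrier_vec k" "y \<noteq> 0\<^sub>v k" and v: "v \<in> carrier_vec (width j)"
  shows "\<exists>B\<in>blocks j. B\<^sup>T *\<^sub>v y = v"
proof (cases "j = h")
  case True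
  then obtain A where A: "A \<in> generated_algebra (companion_matrix p')" "A\<^sup>T *\<^sub>v (0\<^sub>v r @\<^sub>v y) = v"
    using generated_algebra_act_surj[OF p'(1,2) _ padded_nonzero[OF y], of v] p' k v
    by (auto simp: width_def)
  then have "(last_rows k A)\<^sup>T *\<^sub>v y = v"
    using last_rows_mult[OF generated_algebra_carriers(2)[OF A(1)] y(1)] by simp
  then show ?thesis using A True by (auto simp: blocks_def)
next
  case False
  then show ?thesis using generated_algebra_act_surj[OF p(1,2), of y v] p(3) k y v
    by (simp add: blocks_def width_def)
qed

definition reduced :: "nat \<Rightarrow> (nat \<Rightarrow> 'a mat) \<Rightarrow> bool" where
  "reduced i B \<longleftrightarrow> (\<forall>j. 1 \<le> j \<and> j < i \<longrightarrow> B j = 0\<^sub>m k k) \<and> B i = 1\<^sub>m k \<and>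
     (\<forall>j. i < j \<and> j \<le> h \<longrightarrow> B j \<in> blocks j)"

lemma code_matrices_eq:
  assumes "1 \<le> i" "i \<le> h - 1"
  shows "code_matrices k n p p' i = block_row k n ` Collect (reduced i)"
proof -
  have "(\<forall>j. i < j \<and> j \<le> h - 1 \<longrightarrow> B j \<in> generated_algebra (companion_matrix p)) \<and>
      (\<exists>A\<in>generated_algebra (companion_matrix p'). B h = last_rows k A) \<longleftrightarrow>
      (\<forall>j. i < j \<and> j \<le> h \<longrightarrow> B j \<in> blocks j)" for B
  proof -
    have "i < j \<and> j \<le> h \<longleftrightarrow> j = h \<or> i < j \<and> j \<le> h - 1" for j using assms by auto
    moreover have "j \<le> h - 1 \<Longrightarrow> j \<noteq> h" for j using h by auto
    ultimately show ?thesis by (auto simp: blocks_def)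
  qed
  then show ?thesis by (auto simp: code_matrices_def n_div_k reduced_def Let_def)
qed

lemma reduced_block_carrier:
  assumes "reduced i B" "1 \<le> i" "i \<le> h - 1" "1 \<le> j" "j \<le> h"
  shows "B j \<in> carrier_mat k (width j)"
  using assms blocks_carrier[of "B j" j] by (cases i j rule: linorder_cases) (auto simp: reduced_def width_def)

text \<open>The identity in block \<open>i\<close> displays the coefficient vector \<open>y\<close>
  itself. This gives injectivity of the parametrisation and marks the first nonzero block of a
  vector.\<close>

lemma block_reduced:
  assumes B: "reduced i B" and i: "1 \<le> i" "i \<le> h - 1" and y: "y \<in> carrier_vec k"
  shows "1 \<le> j \<Longrightarrow> j < i \<Longrightarrow> block j ((block_row k n B)\<^sup>T *\<^sub>v y) = 0\<^sub>v k"
    and "block i ((block_row k n B)\<^sup>T *\<^sub>v y) = y"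
    and "i < j \<Longrightarrow> j \<le> h \<Longrightarrow> block j ((block_row k n B)\<^sup>T *\<^sub>v y) = (B j)\<^sup>T *\<^sub>v y"
proof -
  have *: "block j ((block_row k n B)\<^sup>T *\<^sub>v y) = (B j)\<^sup>T *\<^sub>v y" if "1 \<le> j" "j \<le> h" for j
    using block_mult[of B j y] reduced_block_carrier[OF B i that] that y by simp
  have "(0\<^sub>m k k :: 'a mat)\<^sup>T *\<^sub>v y = 0\<^sub>v k"
    using y by (intro eq_vecI) auto
  then show "1 \<le> j \<Longrightarrow> j < i \<Longrightarrow> block j ((block_row k n B)\<^sup>T *\<^sub>v y) = 0\<^sub>v k"
    using *[of j] B i by (simp add: reduced_def)
  show "block i ((block_row k n B)\<^sup>T *\<^sub>v y) = y"
    using *[of i] B i y by (simp add: reduced_def)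
  show "i < j \<Longrightarrow> j \<le> h \<Longrightarrow> block j ((block_row k n B)\<^sup>T *\<^sub>v y) = (B j)\<^sup>T *\<^sub>v y"
    using *[of j] i by simp
qed

abbreviation codeword :: "(nat \<Rightarrow> 'a mat) \<Rightarrow> 'a vec set" where
  "codeword B \<equiv> vec_space.row_space n (block_row k n B)"

lemma codeword_eq: "codeword B = (\<lambda>y. (block_row k n B)\<^sup>T *\<^sub>v y) ` carrier_vec k"
  by (rule row_space_image[OF block_row_carrier])

section \<open>The codeword supported on the last \<open>k\<close> coordinates\<close>

definition tail_matrix :: "'a mat" where
  "tail_matrix = mat k n (\<lambda>(a, c). if c = n - k + a then 1 else 0)"

definition last_word :: "'a vec set" where
  "last_word = vec_space.row_space n tail_matrix"

lemma partial_spread_code_eq: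
  "partial_spread_code k n p p' =
     {codeword B | i B. 1 \<le> i \<and> i \<le> h - 1 \<and> reduced i B} \<union> {last_word}"
  by (fastforce simp: partial_spread_code_def n_div_k Let_def last_word_def tail_matrix_def code_matrices_eq)

lemma codeword_in_grassmannian:
  assumes "1 \<le> i" "i \<le> h - 1" "reduced i B"
  shows "codeword B \<in> grassmannian k n"
  using block_reduced(2)[OF assms(3,1,2)]
  by (intro row_space_in_grassmannian block_row_carrier inj_onI) metis

lemma le_n: "k \<le> n" and n_minus: "n - k = (h - 1) * k + r"
proof -
  have "(h - 1) * k + k = h * k" using h by (simp add: mult_eq_if)
  then show "k \<le> n" "n - k = (h - 1) * k + r" using n by auto
qed

lemma tail_matrix_carrier: "tail_matrix \<in> carrier_mat k n"
  by (simp add: tail_matrix_def)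

lemma tail_matrix_mult:
  assumes y: "y \<in> carrier_vec k" and c: "c < n"
  shows "(tail_matrix\<^sup>T *\<^sub>v y) $ c = (if c < n - k then 0 else y $ (c - (n - k)))"
proof -
  define d where "d = n - k"
  \<comment> \<open>For \<open>c < d\<close> the truncated difference \<open>c - d\<close> is 0 and
    would select \<open>i = 0\<close>; the inner condition prevents this.\<close>
  have "tail_matrix $$ (i, c) * y $ i = (if i = c - d then (if c < d then 0 else y $ i) else 0)"
    if "i < k" for i
    using that c by (auto simp: tail_matrix_def simp flip: d_def)
  then have "(tail_matrix\<^sup>T *\<^sub>v y) $ c =
      (\<Sum>i<k. if i = c - d then (if c < d then 0 else y $ i) else 0)"
    using y c tail_matrix_carrier by (subst index_transpose_mult_vec) auto
  also have "\<dots> = (if c < d then 0 else y $ (c - d))"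
    using c le_n by (subst sum.delta) (auto simp: d_def)
  finally show ?thesis by (simp add: d_def)
qed

lemma last_word_eq: "last_word = {v \<in> carrier_vec n. \<forall>c < n - k. v $ c = 0}"
proof -
  have "v \<in> (\<lambda>y. tail_matrix\<^sup>T *\<^sub>v y) ` carrier_vec k" if v: "v \<in> carrier_vec n" "\<forall>c < n - k. v $ c = 0" for v
  proof
    let ?y = "vec k (\<lambda>b. v $ (n - k + b))"
    show "v = tail_matrix\<^sup>T *\<^sub>v ?y"
    proof (rule eq_vecI)
      fix c assume "c < dim_vec (tail_matrix\<^sup>T *\<^sub>v ?y)"
      then have "c < n" using tail_matrix_carrier by simp
      then show "v $ c = (tail_matrix\<^sup>T *\<^sub>v ?y) $ c"
        using v le_n by (subst tail_matrix_mult) auto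
    qed (use v tail_matrix_carrier in simp)
  qed simp
  moreover have "tail_matrix\<^sup>T *\<^sub>v y \<in> {v \<in> carrier_vec n. \<forall>c < n - k. v $ c = 0}"
    if "y \<in> carrier_vec k" for y
  proof -
    have "tail_matrix\<^sup>T *\<^sub>v y \<in> carrier_vec n"
      using tail_matrix_carrier that by (intro mult_mat_vec_carrier) auto
    then show ?thesis using tail_matrix_mult[OF that] by (simp del: index_mult_mat_vec)
  qed
  ultimately show ?thesis unfolding last_word_def row_space_image[OF tail_matrix_carrier] by blast
qed

lemma last_word_in_grassmannian: "last_word \<in> grassmannian k n"
  unfolding last_word_def
proof (rule row_space_in_grassmannian[OF tail_matrix_carrier])
  show "inj_on (\<lambda>y. tail_matrix\<^sup>T *\<^sub>v y) (carrier_vec k)"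
  proof (rule inj_onI, rule eq_vecI)
    fix y z :: "'a vec" and i
    assume yz: "y \<in> carrier_vec k" "z \<in> carrier_vec k"
      and eq: "tail_matrix\<^sup>T *\<^sub>v y = tail_matrix\<^sup>T *\<^sub>v z" and "i < dim_vec z"
    then have i: "n - k + i < n" using le_n by simp
    have "(tail_matrix\<^sup>T *\<^sub>v y) $ (n - k + i) = (tail_matrix\<^sup>T *\<^sub>v z) $ (n - k + i)"
      by (simp only: eq)
    then show "y $ i = z $ i"
      unfolding tail_matrix_mult[OF yz(1) i] tail_matrix_mult[OF yz(2) i] by simp
  qed auto
qed

section \<open>Pairwise trivial intersection of codewords\<close>

lemma block_row_cong:
  assumes "\<And>j. 1 \<le> j \<Longrightarrow> j \<le> h \<Longrightarrow> B j = C j"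
  shows "block_row k n B = block_row k n C"
proof -
  have "B (min (c div k + 1) h) = C (min (c div k + 1) h)" for c
    using assms[of "min (c div k + 1) h"] h by auto
  then show ?thesis by (simp add: block_row_def n_div_k Let_def)
qed

lemma codeword_leading_block:
  assumes B: "reduced i B" "1 \<le> i" "i \<le> h - 1" and v: "v \<in> codeword B" "v \<noteq> 0\<^sub>v n"
  shows "v = (block_row k n B)\<^sup>T *\<^sub>v block i v" "block i v \<in> carrier_vec k" "block i v \<noteq> 0\<^sub>v k"
proof -
  obtain y where y: "y \<in> carrier_vec k" "v = (block_row k n B)\<^sup>T *\<^sub>v y"
    using v codeword_eq by auto
  then have "block i v = y" using block_reduced(2)[OF B y(1)] by simp
  moreover have "y \<noteq> 0\<^sub>v k"
  proof
    assume "y = 0\<^sub>v k"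
    then have "v = 0\<^sub>v n"
      using y block_row_carrier[of B] by (intro eq_vecI) (auto simp: index_transpose_mult_vec simp del: index_mult_mat_vec)
    then show False using v by simp
  qed
  ultimately show "v = (block_row k n B)\<^sup>T *\<^sub>v block i v" "block i v \<in> carrier_vec k" "block i v \<noteq> 0\<^sub>v k"
    using y by auto
qed

text \<open>If \<open>i < j\<close>, block \<open>i\<close> of \<open>v\<close> would be zero by
  membership in \<open>codeword C\<close> and nonzero by membership in \<open>codeword B\<close>.
  Used in both directions, this gives \<open>i = j\<close>.\<close>

lemma codewords_leading_index:
  assumes B: "reduced i B" "1 \<le> i" "i \<le> h - 1" and C: "reduced j C" "1 \<le> j" "j \<le> h - 1"
    and v: "v \<in> codeword B" "v \<in> codeword C" "v \<noteq> 0\<^sub>v n"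
  shows "j \<le> i"
proof (rule ccontr)
  assume "\<not> j \<le> i"
  then have "block i v = 0\<^sub>v k"
    using block_reduced(1)[OF C codeword_leading_block(2)[OF C v(2,3)] B(2)]
      codeword_leading_block(1)[OF C v(2,3)] by simp
  then show False using codeword_leading_block(3)[OF B v(1,3)] by simp
qed

text \<open>A common nonzero vector has the same leading block \<open>y\<close> in both codewords,
  and each later matrix is determined by its value at \<open>y\<close>.\<close>

lemma codewords_eq:
  assumes B: "reduced i B" "1 \<le> i" "i \<le> h - 1" and C: "reduced j C" "1 \<le> j" "j \<le> h - 1"
    and v: "v \<in> codeword B" "v \<in> codeword C" "v \<noteq> 0\<^sub>v n"
  shows "codeword B = codeword C"
proof -
  have "i = j"
    using codewords_leading_index[OF B C v] codewords_leading_index[OF C B v(2,1,3)] by simp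
  note C = C[folded \<open>i = j\<close>]
  let ?y = "block i v"
  note b = codeword_leading_block[OF B v(1,3)]
  note c = codeword_leading_block[OF C v(2,3)]
  have "B l = C l" if "1 \<le> l" "l \<le> h" for l
  proof (cases l i rule: linorder_cases)
    case greater
    have "(B l)\<^sup>T *\<^sub>v ?y = (C l)\<^sup>T *\<^sub>v ?y"
      using block_reduced(3)[OF B b(2) greater that(2)] block_reduced(3)[OF C b(2) greater that(2)] b(1) c(1)
      by metis
    then show ?thesis
      using blocks_act_inj[OF b(2,3), of "B l" l "C l"] B(1) C(1) greater that by (simp add: reduced_def)
  qed (use B(1) C(1) that in \<open>auto simp: reduced_def\<close>)
  \<comment> \<open>Only blocks \<open>1\<close> to \<open>h\<close> enter the matrix; elsewhere
    \<open>B\<close> and \<open>C\<close> may differ.\<close>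
  then show ?thesis using block_row_cong by metis
qed

text \<open>As \<open>i \<le> h - 1\<close>, the leading block ends before coordinate
  \<open>n - k\<close>, where vectors of \<open>last_word\<close> are still zero.\<close>

lemma codeword_last_word:
  assumes B: "reduced i B" "1 \<le> i" "i \<le> h - 1" and v: "v \<in> codeword B" "v \<in> last_word"
  shows "v = 0\<^sub>v n"
proof (rule ccontr)
  assume v0: "v \<noteq> 0\<^sub>v n"
  have "block i v = 0\<^sub>v k"
  proof (rule eq_vecI)
    fix b assume "b < dim_vec (0\<^sub>v k :: 'a vec)"
    then have "(i - 1) * k + b < (i - 1) * k + k" by simp
    also have "\<dots> = i * k" using B by (simp add: mult_eq_if)
    also have "\<dots> \<le> (h - 1) * k" using B by (intro mult_right_mono) auto
    also have "\<dots> \<le> n - k" by (simp add: n_minus)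
    finally show "block i v $ b = 0\<^sub>v k $ b"
      using v(2) \<open>b < dim_vec (0\<^sub>v k)\<close> B by (simp add: block_def width_def last_word_eq)
  qed (use B in \<open>simp add: block_def width_def\<close>)
  then show False using codeword_leading_block(3)[OF B v(1) v0] by simp
qed

lemma partial_spread_code_disjoint:
  assumes W: "W \<in> partial_spread_code k n p p'" "W' \<in> partial_spread_code k n p p'" "W \<noteq> W'"
    and v: "v \<in> W" "v \<in> W'"
  shows "v = 0\<^sub>v n"
proof (rule ccontr)
  assume v0: "v \<noteq> 0\<^sub>v n"
  from W(1,2) consider
      i B j C where "reduced i B" "1 \<le> i" "i \<le> h - 1" "W = codeword B"
        "reduced j C" "1 \<le> j" "j \<le> h - 1" "W' = codeword C"
    | i B where "reduced i B" "1 \<le> i" "i \<le> h - 1" "W = codeword B" "W' = last_word"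
    | i B where "reduced i B" "1 \<le> i" "i \<le> h - 1" "W' = codeword B" "W = last_word"
    | "W = last_word" "W' = last_word"
    unfolding partial_spread_code_eq by auto
  then show False
  proof cases
    case 1
    then show False using codewords_eq[of i B j C v] v v0 W(3) by simp
  next
    case 2
    then show False using codeword_last_word[of i B v] v v0 by simp
  next
    case 3
    then show False using codeword_last_word[of i B v] v v0 by simp
  qed (use W(3) in simp)
qed

text \<open>The first nonzero block of \<open>v\<close> serves as coefficient vector, and
  transitivity supplies matrices that send it to the remaining blocks.\<close>

lemma covered:
  assumes v: "v \<in> carrier_vec n" and c: "c < (h - 1) * k" "v $ c \<noteq> 0"
  shows "\<exists>W\<in>partial_spread_code k n p p'. v \<in> W"
proof -
  \<comment> \<open>The first nonzero position: it selects the block \<open>i\<close>, and all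
    earlier blocks vanish.\<close>
  define c0 where "c0 = (LEAST c. v $ c \<noteq> 0)"
  have c0: "v $ c0 \<noteq> 0" "c0 \<le> c" and below: "\<And>c. c < c0 \<Longrightarrow> v $ c = 0"
    unfolding c0_def
    by (rule LeastI[of _ c], rule c) (rule Least_le, rule c, use not_less_Least in blast)
  define i where "i = c0 div k + 1"
  have i: "1 \<le> i" "i \<le> h - 1"
  proof -
    have "c0 div k < h - 1" using c c0 k by (simp add: less_mult_imp_div_less)
    then show "1 \<le> i" "i \<le> h - 1" by (auto simp: i_def)
  qed
  then have ih: "i \<noteq> h" by auto
  let ?y = "block i v"
  have y: "?y \<in> carrier_vec k" using ih by (simp add: block_def width_def)
  have "?y $ (c0 mod k) \<noteq> 0" using c0 k ih by (simp add: block_def width_def i_def)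
  then have y0: "?y \<noteq> 0\<^sub>v k" using k by auto
  \<comment> \<open>One matrix for each block after \<open>i\<close>, then collected in a single
    function \<open>C\<close>.\<close>
  have "\<exists>B. j \<in> {i<..h} \<longrightarrow> B \<in> blocks j \<and> B\<^sup>T *\<^sub>v ?y = block j v" for j
    using blocks_act_surj[OF y y0, of "block j v" j] by (auto simp: block_def)
  then obtain C where C: "\<And>j. i < j \<Longrightarrow> j \<le> h \<Longrightarrow> C j \<in> blocks j \<and> (C j)\<^sup>T *\<^sub>v ?y = block j v"
    by (metis greaterThanAtMost_iff)
  define B where "B j = (if j < i then 0\<^sub>m k k else if j = i then 1\<^sub>m k else C j)" for j
  have B: "reduced i B" using C by (auto simp: reduced_def B_def)
  have "(block_row k n B)\<^sup>T *\<^sub>v ?y = v"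
  proof (rule eq_if_blocks_eq)
    show "(block_row k n B)\<^sup>T *\<^sub>v ?y \<in> carrier_vec n"
      using block_row_carrier y by (intro mult_mat_vec_carrier) auto
    fix j assume j: "1 \<le> j" "j \<le> h"
    show "block j ((block_row k n B)\<^sup>T *\<^sub>v ?y) = block j v"
    proof (cases j i rule: linorder_cases)
      case less
      have "block j v = 0\<^sub>v k"
      proof (rule eq_vecI)
        fix b assume "b < dim_vec (0\<^sub>v k :: 'a vec)"
        then have b: "b < k" by simp
        have "(j - 1) * k + b < (j - 1) * k + k" using b by simp
        also have "\<dots> = j * k" using j by (simp add: mult_eq_if)
        also have "\<dots> \<le> (i - 1) * k" using less by (intro mult_right_mono) auto
        also have "\<dots> \<le> c0" by (simp add: i_def)
        finally show "block j v $ b = 0\<^sub>v k $ b"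
          using b below less i by (simp add: block_def width_def)
      qed (use less i in \<open>simp add: block_def width_def\<close>)
      then show ?thesis using block_reduced(1)[OF B i y j(1) less] by simp
    next
      case equal
      then show ?thesis using block_reduced(2)[OF B i y] by simp
    next
      case greater
      then show ?thesis using block_reduced(3)[OF B i y greater j(2)] C[OF greater j(2)] by (simp add: B_def)
    qed
  qed (use v in simp)
  then have "v \<in> codeword B" using y codeword_eq by (metis imageI)
  then show ?thesis using B i partial_spread_code_eq by blast
qed

section \<open>The code property and maximality\<close>

lemma partial_spread_code_grassmannian: "partial_spread_code k n p p' \<subseteq> grassmannian k n"
  using codeword_in_grassmannian last_word_in_grassmannian unfolding partial_spread_code_eq by auto

lemma partial_spread_code_in_network_codes:
  "partial_spread_code k n p p' \<in> network_codes k n (2 * k)"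
  unfolding network_codes_2k_iff
proof (intro conjI ballI impI)
  let ?C = "partial_spread_code k n p p'"
  show "?C \<subseteq> grassmannian k n" by (rule partial_spread_code_grassmannian)
  then have fin: "finite ?C" using finite_grassmannian finite_subset by blast
  have "0 < n" using n h k by simp
  moreover have "0 < (h - 1) * k" using h k by simp
  \<comment> \<open>A second codeword: the one through the first unit vector, which is not in
    \<open>last_word\<close>.\<close>
  ultimately obtain W where W: "W \<in> ?C" "unit_vec n 0 \<in> W"
    using covered[of "unit_vec n 0" 0] by auto
  have "(unit_vec n 0 :: 'a vec) \<notin> last_word"
  proof
    assume "(unit_vec n 0 :: 'a vec) \<in> last_word"
    moreover have "0 < n - k" using \<open>0 < (h - 1) * k\<close> by (simp only: n_minus)
    ultimately have "(unit_vec n 0 :: 'a vec) $ 0 = 0" unfolding last_word_eq by blast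
    then show False using \<open>0 < n\<close> by simp
  qed
  then have "W \<noteq> last_word" using W by auto
  then have "card {W, last_word} = 2" by simp
  moreover have "{W, last_word} \<subseteq> ?C" using W partial_spread_code_eq by auto
  ultimately show "2 \<le> card ?C" using card_mono[OF fin] by metis
  fix U V assume UV: "U \<in> ?C" "V \<in> ?C" "U \<noteq> V"
  have "0\<^sub>v n \<in> U \<inter> V"
    using UV partial_spread_code_grassmannian by (auto intro: zero_in_grassmannian)
  then show "U \<inter> V = {0\<^sub>v n}" using partial_spread_code_disjoint[OF UV] by auto
qed

lemma subspace_meets_codeword:
  assumes U: "U \<in> grassmannian k n"
  shows "\<exists>W\<in>partial_spread_code k n p p'. U \<inter> W \<noteq> {0\<^sub>v n}"
proof (rule ccontr)
  assume "\<not> ?thesis"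
  then have disj: "\<And>W. W \<in> partial_spread_code k n p p' \<Longrightarrow> U \<inter> W = {0\<^sub>v n}" by blast
  have sub: "VectorSpace.subspace class_ring U (module_vec TYPE('a) n)" and dim: "subspace_dim n U = k"
    using U by (simp_all add: grassmannian_def)
  note U_facts = subspace_facts[OF sub]
  let ?d = "(h - 1) * k"
  \<comment> \<open>Otherwise \<open>u\<close> would be a nonzero vector in some codeword.\<close>
  have zero: "u $ c = 0" if u: "u \<in> U" and c: "c < ?d" for u c
  proof (rule ccontr)
    assume "u $ c \<noteq> 0"
    then obtain W where "W \<in> partial_spread_code k n p p'" "u \<in> W"
      using covered[of u c] u c U_facts(1) by blast
    then have "u = 0\<^sub>v n" using disj u by blast
    moreover have "c < n" using c n_minus by linarith
    ultimately show False using \<open>u $ c \<noteq> 0\<close> by simp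
  qed
  \<comment> \<open>The \<open>r\<close> coordinates between the first \<open>(h - 1) * k\<close>,
    where \<open>U\<close> vanishes, and the last \<open>k\<close>, which carry
    \<open>last_word\<close>.\<close>
  let ?\<pi> = "\<lambda>u. vec r (\<lambda>i. u $ (?d + i))"
  have "inj_on ?\<pi> U"
  proof (rule inj_onI)
    fix u v assume uv: "u \<in> U" "v \<in> U" "?\<pi> u = ?\<pi> v"
    have carr: "u \<in> carrier_vec n" "v \<in> carrier_vec n" using uv U_facts(1) by auto
    have "u $ c = v $ c" if c: "c < n - k" for c
    proof (cases "c < ?d")
      case False
      then have "?\<pi> u $ (c - ?d) = ?\<pi> v $ (c - ?d)" "c - ?d < r" using uv c n_minus by auto
      then show ?thesis using False by simp
    qed (use zero uv in simp)
    \<comment> \<open>Equal images leave a difference supported on the last \<open>k\<close>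
      coordinates, and \<open>U\<close> meets \<open>last_word\<close> only in zero.\<close>
    then have "u - v \<in> last_word" using carr by (auto simp: last_word_eq)
    then have "u - v = 0\<^sub>v n"
      using disj[of last_word] subspace_diff[OF sub uv(1,2)] partial_spread_code_eq by blast
    then have "(u - v) $ c = 0" if "c < n" for c using that by simp
    then show "u = v" using carr by (intro eq_vecI) auto
  qed
  moreover have "?\<pi> ` U \<subseteq> carrier_vec r" by auto
  ultimately have "card U \<le> card (carrier_vec r :: 'a vec set)"
    using card_inj_on_le finite_carrier_vec by blast
  then have "CARD('a) ^ k \<le> CARD('a) ^ r"
    using card_subspace[OF sub] dim by (simp add: card_carrier_vec)
  then show False using r card_field_gt_1[where 'a='a] by simp
qed

text \<open>Any \<open>U\<close> in \<open>D\<close> meets some codeword \<open>W\<close>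
  nontrivially; both belong to \<open>D\<close>, where distinct members meet trivially, so
  \<open>U = W\<close>.\<close>

lemma partial_spread_code_maximal:
  assumes D: "D \<in> network_codes k n (2 * k)" and sub: "partial_spread_code k n p p' \<subseteq> D"
  shows "D = partial_spread_code k n p p'"
proof (rule antisym[OF subsetI sub])
  from D have D': "D \<subseteq> grassmannian k n"
    "\<And>U V. U \<in> D \<Longrightarrow> V \<in> D \<Longrightarrow> U \<noteq> V \<Longrightarrow> U \<inter> V = {0\<^sub>v n}"
    unfolding network_codes_2k_iff by auto
  fix U assume U: "U \<in> D"
  then obtain W where W: "W \<in> partial_spread_code k n p p'" "U \<inter> W \<noteq> {0\<^sub>v n}"
    using subspace_meets_codeword D' by blast
  then have "U = W" using D'(2)[OF U, of W] sub by auto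
  then show "U \<in> partial_spread_code k n p p'" using W by simp
qed

end

theorem proposition20:
  fixes k n h r :: nat and p p' :: "'a::{field,finite} poly"
  assumes "1 \<le> k" and "k < n" and "real k \<le> real n / 2"
    and "n = h * k + r" and "0 \<le> r" and "r \<le> k - 1"
    and "irreducible p" and "lead_coeff p = 1" and "degree p = k"
    and "irreducible p'" and "lead_coeff p' = 1" and "degree p' = k + r"
  shows "partial_spread_code k n p p' \<in> network_codes k n (2 * k) \<and>
    (\<forall>D \<in> network_codes k n (2 * k).
       partial_spread_code k n p p' \<subseteq> D \<longrightarrow> D = partial_spread_code k n p p')"
proof -
  have "2 * k \<le> n" using assms(3) by linarith
  \<comment> \<open>Since \<open>r < k\<close>; together with \<open>2 * k \<le> n\<close> this
    forces \<open>2 \<le> h\<close>.\<close>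
  also have "n < (h + 1) * k" using assms(1,4,6) by (simp add: algebra_simps)
  finally have "2 * k < (h + 1) * k" .
  then have "2 \<le> h" using mult_less_cancel2[of 2 k "h + 1"] by simp
  then interpret partial_spread k n h r p p'
    using assms by unfold_locales auto
  show ?thesis using partial_spread_code_in_network_codes partial_spread_code_maximal by blast
qed

end
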